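(* If $X$ is a non-compact regular Hausdorff space and $\mathcal A$ is an ideal of compact subsets of $X$, then \[\psi_k(X) \leq L_{\mathrm{st}}(\mathrm{PR}_{\mathcal A}(X)).\]
   Context: An ideal of compact subsets of $X$ is a collection $\mathcal A$ of compact subsets of $X$ such that $A\cup B\in\mathcal A$ whenever $A,B\in\mathcal A$ and $\{x\}\in\mathcal A$ for every $x\in X$ (so $\mathcal A$ covers $X$). $\mathrm{PR}_{\mathcal A}(X)$ is the set $\mathcal A$ with the topology having as basis the sets $[A,U]=\{B\in\mathcal A:A\subseteq B\subseteq U\}$, where $A\in\mathcal A$ and $U\subseteq X$ is open. The $k$-pseudocharacter $\psi_k(X)$ is the least cardinal $\kappa$ such that every compact subset of $X$ is the intersection of at most $\kappa$ open sets. For an open cover $\mathscr U$ of a space $Y$ and $A\subseteq Y$, $\mathrm{St}(A,\mathscr U)=\bigcup\{U\in\mathscr U:U\cap A\neq\emptyset\}$. The star-Lindelöf degree $L_{\mathrm{st}}(Y)$ is the least cardinal $\kappa$ such that every open cover $\mathscr U$ of $Y$ has a subcollection $\mathscr V$ of size at most $\kappa$ with $\{\mathrm{St}(U,\mathscr U):U\in\mathscr V\}$ a cover of $Y$. *)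

theory Defs
  imports "HOL-Analysis.Analysis"
begin

unbundle cardinal_syntax

definition compact_ideal :: "'a topology \<Rightarrow> 'a set set \<Rightarrow> bool" where
  "compact_ideal X \<A> \<longleftrightarrow>
     (\<forall>A\<in>\<A>. compactin X A) \<and>
     (\<forall>A\<in>\<A>. \<forall>B\<in>\<A>. A \<union> B \<in> \<A>) \<and>
     (\<forall>x\<in>topspace X. {x} \<in> \<A>)"

definition PR_nbhd :: "'a set set \<Rightarrow> 'a set \<Rightarrow> 'a set \<Rightarrow> 'a set set" where
  "PR_nbhd \<A> A U = {B\<in>\<A>. A \<subseteq> B \<and> B \<subseteq> U}"

definition PR :: "'a set set \<Rightarrow> 'a topology \<Rightarrow> 'a set topology" where
  "PR \<A> X =
     topology (arbitrary union_of (\<lambda>W. \<exists>A\<in>\<A>. \<exists>U. openin X U \<and> W = PR_nbhd \<A> A U))"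

lemma openin_PR:
  assumes "compact_ideal X \<A>"
  shows "openin (PR \<A> X) =
           arbitrary union_of (\<lambda>W. \<exists>A\<in>\<A>. \<exists>U. openin X U \<and> W = PR_nbhd \<A> A U)"
proof -
  have "\<exists>A\<in>\<A>. \<exists>U. openin X U \<and> S \<inter> T = PR_nbhd \<A> A U"
    if ST: "\<exists>A\<in>\<A>. \<exists>U. openin X U \<and> S = PR_nbhd \<A> A U"
       "\<exists>A\<in>\<A>. \<exists>U. openin X U \<and> T = PR_nbhd \<A> A U" for S T
  proof -
    obtain A U B V where *: "A \<in> \<A>" "openin X U" "S = PR_nbhd \<A> A U"
        "B \<in> \<A>" "openin X V" "T = PR_nbhd \<A> B V"
      using ST by metis
    then have "S \<inter> T = PR_nbhd \<A> (A \<union> B) (U \<inter> V)"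
      by (auto simp: PR_nbhd_def)
    moreover have "A \<union> B \<in> \<A>" "openin X (U \<inter> V)"
      using * assms by (auto simp: compact_ideal_def)
    ultimately show ?thesis by blast
  qed
  then show ?thesis
    unfolding PR_def
    by (intro topology_inverse' istopology_base) auto
qed

lemma topspace_PR:
  assumes "compact_ideal X \<A>"
  shows "topspace (PR \<A> X) = \<A>"
proof
  show "topspace (PR \<A> X) \<subseteq> \<A>"
    using openin_topspace[of "PR \<A> X"]
    unfolding openin_PR[OF assms] union_of_def PR_nbhd_def by blast
  have "PR_nbhd \<A> A (topspace X) \<subseteq> topspace (PR \<A> X)" if "A \<in> \<A>" for A
    using that openin_topspace[of X]
    by (intro openin_subset, unfold openin_PR[OF assms]) (rule arbitrary_union_of_inc, blast)
  moreover have "A \<in> PR_nbhd \<A> A (topspace X)" if "A \<in> \<A>" for A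
    using that assms by (auto simp: PR_nbhd_def compact_ideal_def dest: compactin_subset_topspace)
  ultimately show "\<A> \<subseteq> topspace (PR \<A> X)" by blast
qed

(* Cardinals are represented by initial well-orders, so they live on a type and are unique only
   up to =o; least_cardinal ranges over the cardinals on the type 'c.  The lemmas
   k_pseudocharacter_props and star_Lindelof_props show that, at the types used below, the
   value is a least one among the cardinals on all types. *)
definition least_cardinal :: "('c rel \<Rightarrow> bool) \<Rightarrow> 'c rel" where
  "least_cardinal P =
     (SOME \<kappa>. Card_order \<kappa> \<and> P \<kappa> \<and> (\<forall>\<kappa>'. Card_order \<kappa>' \<and> P \<kappa>' \<longrightarrow> \<kappa> \<le>o \<kappa>'))"

(* Intersections are taken in X: the empty family has intersection topspace X. *)
definition k_pseudocharacter_le :: "'a topology \<Rightarrow> 'k rel \<Rightarrow> bool" where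
  "k_pseudocharacter_le X \<kappa> \<longleftrightarrow>
     (\<forall>K. compactin X K \<longrightarrow>
        (\<exists>\<V>. (\<forall>V\<in>\<V>. openin X V) \<and> |\<V>| \<le>o \<kappa> \<and> K = topspace X \<inter> \<Inter>\<V>))"

definition k_pseudocharacter :: "'a topology \<Rightarrow> 'a set rel" where
  "k_pseudocharacter X = least_cardinal (k_pseudocharacter_le X)"

definition St :: "'a set \<Rightarrow> 'a set set \<Rightarrow> 'a set" where
  "St A \<U> = \<Union>{U\<in>\<U>. U \<inter> A \<noteq> {}}"

definition open_cover :: "'a topology \<Rightarrow> 'a set set \<Rightarrow> bool" where
  "open_cover Y \<U> \<longleftrightarrow> (\<forall>U\<in>\<U>. openin Y U) \<and> \<Union>\<U> = topspace Y"

definition star_Lindelof_le :: "'a topology \<Rightarrow> 'k rel \<Rightarrow> bool" where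
  "star_Lindelof_le Y \<kappa> \<longleftrightarrow>
     (\<forall>\<U>. open_cover Y \<U> \<longrightarrow>
        (\<exists>\<V>\<subseteq>\<U>. |\<V>| \<le>o \<kappa> \<and> (\<Union>U\<in>\<V>. St U \<U>) = topspace Y))"

definition star_Lindelof_degree :: "'a topology \<Rightarrow> 'a set rel" where
  "star_Lindelof_degree Y = least_cardinal (star_Lindelof_le Y)"

lemma least_cardinal_props:
  fixes P :: "'c rel \<Rightarrow> bool"
  assumes "Card_order \<kappa>0" "P \<kappa>0"
  shows "Card_order (least_cardinal P)" "P (least_cardinal P)"
    "\<And>\<kappa>. Card_order \<kappa> \<Longrightarrow> P \<kappa> \<Longrightarrow> least_cardinal P \<le>o \<kappa>"
proof -
  have "\<exists>r\<in>{\<kappa>. Card_order \<kappa> \<and> P \<kappa>}. \<forall>r'\<in>{\<kappa>. Card_order \<kappa> \<and> P \<kappa>}. r \<le>o r'"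
    using assms by (intro exists_minim_Card_order) auto
  then have "\<exists>\<kappa>. Card_order \<kappa> \<and> P \<kappa> \<and> (\<forall>\<kappa>'. Card_order \<kappa>' \<and> P \<kappa>' \<longrightarrow> \<kappa> \<le>o \<kappa>')"
    by blast
  from someI_ex[OF this]
  show "Card_order (least_cardinal P)" "P (least_cardinal P)"
    "\<And>\<kappa>. Card_order \<kappa> \<Longrightarrow> P \<kappa> \<Longrightarrow> least_cardinal P \<le>o \<kappa>"
    unfolding least_cardinal_def by blast+
qed

lemma least_cardinal_le:
  fixes P :: "'c rel \<Rightarrow> bool" and \<kappa> :: "'k rel"
  assumes P: "P |UNIV :: 'c set|" and \<kappa>: "Card_order \<kappa>"
    and transfer: "\<And>\<kappa>' :: 'c rel. \<kappa> =o \<kappa>' \<Longrightarrow> P \<kappa>'"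
  shows "least_cardinal P \<le>o \<kappa>"
proof -
  consider "\<kappa> \<le>o |UNIV :: 'c set|" | "|UNIV :: 'c set| \<le>o \<kappa>"
    using ordLeq_total[OF card_order_on_well_order_on[OF \<kappa>] card_of_Well_order[of "UNIV :: 'c set"]]
    by blast
  then show ?thesis
  proof cases
    case 1
    obtain \<kappa>' :: "'c rel" where "\<kappa> =o \<kappa>'"
      using 1 internalize_ordLeq[of \<kappa> "|UNIV :: 'c set|"] by blast
    have "least_cardinal P \<le>o \<kappa>'"
      by (rule least_cardinal_props(3)[OF card_of_Card_order P
            Card_order_ordIso2[OF \<kappa> \<open>\<kappa> =o \<kappa>'\<close>] transfer[OF \<open>\<kappa> =o \<kappa>'\<close>]])
    then show ?thesis
      by (rule ordLeq_ordIso_trans[OF _ ordIso_symmetric[OF \<open>\<kappa> =o \<kappa>'\<close>]])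
  next
    case 2
    then show ?thesis
      using least_cardinal_props(3)[of "|UNIV :: 'c set|" P "|UNIV :: 'c set|"] P
        card_of_Card_order ordLeq_transitive by blast
  qed
qed

lemma k_pseudocharacter_le_UNIV:
  fixes X :: "'a topology"
  assumes "Hausdorff_space X"
  shows "k_pseudocharacter_le X |UNIV :: 'a set set|"
  unfolding k_pseudocharacter_le_def
proof (intro allI impI)
  fix K assume K: "compactin X K"
  let ?\<V> = "{V. openin X V \<and> K \<subseteq> V}"
  have "openin X (topspace X - {x})" if "x \<in> topspace X" for x
    using that assms by (simp add: closedin_Hausdorff_singleton openin_diff)
  then have "topspace X \<inter> \<Inter>?\<V> \<subseteq> K"
    using compactin_subset_topspace[OF K] by blast
  then have "K = topspace X \<inter> \<Inter>?\<V>"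
    using compactin_subset_topspace[OF K] by blast
  then show "\<exists>\<V>. (\<forall>V\<in>\<V>. openin X V) \<and> |\<V>| \<le>o |UNIV :: 'a set set| \<and> K = topspace X \<inter> \<Inter>\<V>"
    by (intro exI[of _ ?\<V>]) (auto intro: card_of_mono1)
qed

lemma k_pseudocharacter_props:
  fixes X :: "'a topology"
  assumes "Hausdorff_space X"
  shows "Card_order (k_pseudocharacter X)"
    and "k_pseudocharacter_le X (k_pseudocharacter X)"
    and "\<And>\<kappa> :: 'k rel. Card_order \<kappa> \<Longrightarrow> k_pseudocharacter_le X \<kappa> \<Longrightarrow> k_pseudocharacter X \<le>o \<kappa>"
proof -
  note U = k_pseudocharacter_le_UNIV[OF assms]
  show "Card_order (k_pseudocharacter X)" "k_pseudocharacter_le X (k_pseudocharacter X)"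
    unfolding k_pseudocharacter_def
    using least_cardinal_props[of "|UNIV :: 'a set set|" "k_pseudocharacter_le X"] U
    by (auto simp: card_of_Card_order)
  fix \<kappa> :: "'k rel" assume "Card_order \<kappa>" "k_pseudocharacter_le X \<kappa>"
  then show "k_pseudocharacter X \<le>o \<kappa>"
    unfolding k_pseudocharacter_def
    by (intro least_cardinal_le U) (auto simp: k_pseudocharacter_le_def, meson ordLeq_ordIso_trans)
qed

lemma star_Lindelof_le_UNIV: "star_Lindelof_le Y |UNIV :: 'a set set|" for Y :: "'a topology"
  unfolding star_Lindelof_le_def
proof (intro allI impI)
  fix \<U> assume \<U>: "open_cover Y \<U>"
  have "(\<Union>U\<in>\<U>. St U \<U>) = \<Union>\<U>"
    unfolding St_def by blast
  then show "\<exists>\<V>\<subseteq>\<U>. |\<V>| \<le>o |UNIV :: 'a set set| \<and> (\<Union>U\<in>\<V>. St U \<U>) = topspace Y"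
    using \<U> by (intro exI[of _ \<U>]) (auto simp: open_cover_def intro: card_of_mono1)
qed

lemma star_Lindelof_props:
  fixes Y :: "'a topology"
  shows "Card_order (star_Lindelof_degree Y)"
    and "star_Lindelof_le Y (star_Lindelof_degree Y)"
    and "\<And>\<kappa> :: 'k rel. Card_order \<kappa> \<Longrightarrow> star_Lindelof_le Y \<kappa> \<Longrightarrow> star_Lindelof_degree Y \<le>o \<kappa>"
proof -
  note U = star_Lindelof_le_UNIV[of Y]
  show "Card_order (star_Lindelof_degree Y)" "star_Lindelof_le Y (star_Lindelof_degree Y)"
    unfolding star_Lindelof_degree_def
    using least_cardinal_props[of "|UNIV :: 'a set set|" "star_Lindelof_le Y"] U
    by (auto simp: card_of_Card_order)
  fix \<kappa> :: "'k rel" assume "Card_order \<kappa>" "star_Lindelof_le Y \<kappa>"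
  then show "star_Lindelof_degree Y \<le>o \<kappa>"
    unfolding star_Lindelof_degree_def
    by (intro least_cardinal_le U) (auto simp: star_Lindelof_le_def, meson ordLeq_ordIso_trans)
qed

end

(* For a compact set K, separate every A in \<A> that misses K from K by disjoint open sets
   U A and V A, and apply the star-Lindelof property to the cover of PR \<A> X by the sets
   [A, U A].  If {x} with x outside K lies in the star of a chosen [A, U A], then A is
   contained in U {x}, so A misses K; and x lies in U A, so x is outside V A.  Hence K is the
   intersection of the sets V A over the chosen A. *)
theory Submission
  imports Defs
begin

lemma openin_PR_nbhd:
  assumes "compact_ideal X \<A>" "A \<in> \<A>" "openin X U"
  shows "openin (PR \<A> X) (PR_nbhd \<A> A U)"
  unfolding openin_PR[OF assms(1)] using assms(2,3) by (intro arbitrary_union_of_inc) blast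

text \<open>Each \<open>A\<close> is a point of its own \<open>[A, U A]\<close>, so one basic set
  per member of \<open>\<A>\<close> already covers.\<close>

lemma open_cover_PR_nbhd:
  assumes ideal: "compact_ideal X \<A>"
    and U: "\<And>A. A \<in> \<A> \<Longrightarrow> openin X (U A) \<and> A \<subseteq> U A"
  shows "open_cover (PR \<A> X) ((\<lambda>A. PR_nbhd \<A> A (U A)) ` \<A>)"
  unfolding open_cover_def topspace_PR[OF ideal]
proof (intro conjI equalityI subsetI ballI)
  fix W assume "W \<in> (\<lambda>A. PR_nbhd \<A> A (U A)) ` \<A>"
  then show "openin (PR \<A> X) W"
    using U openin_PR_nbhd[OF ideal] by blast
next
  fix A assume "A \<in> \<A>"
  then have "A \<in> PR_nbhd \<A> A (U A)"
    using U by (simp add: PR_nbhd_def)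
  with \<open>A \<in> \<A>\<close> show "A \<in> \<Union>((\<lambda>A. PR_nbhd \<A> A (U A)) ` \<A>)" by blast
qed (auto simp: PR_nbhd_def)

text \<open>The type of \<open>\<kappa>\<close> is left arbitrary because the two cardinals to be
  compared live on different types, \<open>'a set\<close> and \<open>'a set set\<close>.\<close>

lemma k_pseudocharacter_le_if_star_Lindelof_le_PR:
  fixes \<kappa> :: "'k rel"
  assumes haus: "Hausdorff_space X" and ideal: "compact_ideal X \<A>"
    and star: "star_Lindelof_le (PR \<A> X) \<kappa>"
  shows "k_pseudocharacter_le X \<kappa>"
  unfolding k_pseudocharacter_le_def
proof (intro allI impI)
  fix K assume K: "compactin X K"
  then have KX: "K \<subseteq> topspace X"
    by (rule compactin_subset_topspace)
  \<comment> \<open>Taking \<open>U {} = {}\<close> makes \<open>{{x}}\<close> meet \<open>[C, U C]\<close> only for \<open>C = {x}\<close>, also when \<open>{} \<in> \<A>\<close>.\<close>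
  have "\<exists>U V. openin X U \<and> openin X V \<and> A \<subseteq> U \<and> K \<subseteq> V \<and> (A \<inter> K = {} \<longrightarrow> U \<inter> V = {})
      \<and> (A = {} \<longrightarrow> U = {})" if "A \<in> \<A>" for A
  proof -
    have A: "compactin X A"
      using that ideal by (simp add: compact_ideal_def)
    consider "A = {}" | "A \<noteq> {}" "A \<inter> K \<noteq> {}" | "A \<noteq> {}" "A \<inter> K = {}" by blast
    then show ?thesis
    proof cases
      case 1
      then show ?thesis using KX by (intro exI[of _ "{}"] exI[of _ "topspace X"]) auto
    next
      \<comment> \<open>A set meeting \<open>K\<close> cannot be separated from it but still needs a
        neighbourhood for the cover; \<open>topspace X\<close> serves as both \<open>U\<close> and
        \<open>V\<close>.\<close>
      case 2
      then show ?thesis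
        using KX compactin_subset_topspace[OF A]
        by (intro exI[of _ "topspace X"]) auto
    next
      case 3
      then show ?thesis
        using haus A K unfolding Hausdorff_space_compact_sets disjnt_def by metis
    qed
  qed
  then obtain U V where
    UV: "\<And>A. A \<in> \<A> \<Longrightarrow> openin X (U A) \<and> openin X (V A) \<and> A \<subseteq> U A \<and> K \<subseteq> V A
      \<and> (A \<inter> K = {} \<longrightarrow> U A \<inter> V A = {}) \<and> (A = {} \<longrightarrow> U A = {})"
    by metis
  define N where "N = (\<lambda>A. PR_nbhd \<A> A (U A))"
  have "open_cover (PR \<A> X) (N ` \<A>)"
    unfolding N_def by (rule open_cover_PR_nbhd[OF ideal]) (simp add: UV)
  then obtain \<W> where \<W>: "\<W> \<subseteq> N ` \<A>" "|\<W>| \<le>o \<kappa>" "(\<Union>W\<in>\<W>. St W (N ` \<A>)) = \<A>"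
    using star unfolding star_Lindelof_le_def topspace_PR[OF ideal] by meson
  \<comment> \<open>\<open>c\<close> recovers the centre of each chosen basic set, so the final
    family is indexed by \<open>\<W>\<close> and has size at most \<open>\<kappa>\<close>.\<close>
  then obtain c where c: "\<And>W. W \<in> \<W> \<Longrightarrow> c W \<in> \<A> \<and> W = N (c W)"
    unfolding subset_eq image_iff by metis
  have "\<exists>W\<in>\<W>. x \<notin> V (c W)" if x: "x \<in> topspace X" "x \<notin> K" for x
  proof -
    have x\<A>: "{x} \<in> \<A>"
      using ideal x by (simp add: compact_ideal_def)
    then obtain W where W: "W \<in> \<W>" "{x} \<in> St W (N ` \<A>)"
      using \<W>(3) by blast
    then obtain C where C: "C \<in> \<A>" "{x} \<in> N C" "N C \<inter> W \<noteq> {}"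
      unfolding St_def by auto
    then have "C \<subseteq> {x}" "x \<in> U C"
      by (auto simp: N_def PR_nbhd_def)
    then have "C = {x}"
      using UV[OF C(1)] by blast
    have W_eq: "W = N (c W)" and cW: "c W \<in> \<A>"
      using c[OF W(1)] by blast+
    \<comment> \<open>A common point \<open>D\<close> of the two basic sets links their centres:
      \<open>c W \<subseteq> D \<subseteq> U {x}\<close> and
      \<open>x \<in> D \<subseteq> U (c W)\<close>.\<close>
    obtain D where "D \<in> N {x}" "D \<in> N (c W)"
      using C(3) W_eq \<open>C = {x}\<close> by blast
    then have "{x} \<subseteq> D" "D \<subseteq> U {x}" "c W \<subseteq> D" "D \<subseteq> U (c W)"
      by (simp_all add: N_def PR_nbhd_def)
    moreover have "U {x} \<inter> K = {}"
      using UV[OF x\<A>] x by blast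
    ultimately have "x \<notin> V (c W)"
      using UV[OF cW] by blast
    with W show ?thesis by blast
  qed
  moreover have "openin X (V (c W))" "K \<subseteq> V (c W)" if "W \<in> \<W>" for W
    using UV c[OF that] by blast+
  moreover have "|(\<lambda>W. V (c W)) ` \<W>| \<le>o \<kappa>"
    using card_of_image \<W>(2) by (rule ordLeq_transitive)
  \<comment> \<open>The two facts used are that every point outside \<open>K\<close> is missed by
    some \<open>V (c W)\<close>, and that each \<open>V (c W)\<close> contains
    \<open>K\<close>.\<close>
  moreover have "K = topspace X \<inter> \<Inter>((\<lambda>W. V (c W)) ` \<W>)"
    using KX calculation(1,3) by blast
  ultimately show "\<exists>\<V>. (\<forall>V\<in>\<V>. openin X V) \<and> |\<V>| \<le>o \<kappa> \<and> K = topspace X \<inter> \<Inter>\<V>"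
    by (intro exI[of _ "(\<lambda>W. V (c W)) ` \<W>"] conjI ballI) auto
qed

theorem proposition3p12:
  fixes X :: "'a topology" and \<A> :: "'a set set"
  assumes "\<not> compact_space X"
    and "regular_space X"
    and "Hausdorff_space X"
    and "compact_ideal X \<A>"
  shows "k_pseudocharacter X \<le>o star_Lindelof_degree (PR \<A> X)"
  using k_pseudocharacter_props(3)[OF assms(3) star_Lindelof_props(1)]
    k_pseudocharacter_le_if_star_Lindelof_le_PR[OF assms(3,4) star_Lindelof_props(2)]
  by blast

end
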